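(* Let $n\ge 1$ and let $h(x) = c_0 + c_1 x + \cdots + c_n x^n \in \mathbb{R}_n[x]$ be a polynomial with nonnegative coefficients. For a positive integer $r$, define $\mathcal{U}^n_r(h(x)) \in \mathbb{R}_n[x]$ by \[ \frac{\mathcal{U}^n_r(h(x))}{(1-x)^n} = \sum_{m \ge 0} a_{rm} x^m \quad \text{where} \quad \frac{h(x)}{(1-x)^n} = \sum_{m \ge 0} a_m x^m. \] (a) If $c_0 + c_1 + \cdots + c_i \le c_n + c_{n-1} + \cdots + c_{n-i}$ for all $0 \le i \le \lfloor n/2 \rfloor$, then $\mathcal{U}^n_r(h(x))$ has a nonnegative, real-rooted symmetric decomposition with respect to $n$ for every $r \ge n$. (b) If $c_n = 0$ and $c_0 + c_1 + \cdots + c_i \ge c_{n-1} + c_{n-2} + \cdots + c_{n-i}$ for all $1 \le i \le \lfloor n/2 \rfloor$, then $\mathcal{U}^n_r(h(x))$ has a nonnegative, real-rooted symmetric decomposition with respect to $n-1$ for every $r \ge n$.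
   Context: $\mathbb{R}_n[x]$ denotes the space of real polynomials of degree at most $n$. A polynomial is real-rooted if all its roots are real or it is identically zero. Every $p(x)\in\mathbb{R}_m[x]$ can be written uniquely as $p(x)=a(x)+x\,b(x)$ with $a(x)=x^m a(1/x)$ and $b(x)=x^{m-1}b(1/x)$; this is the symmetric decomposition of $p$ with respect to $m$. It is called nonnegative (resp. real-rooted) if both $a(x)$ and $b(x)$ have nonnegative coefficients (resp. are real-rooted). *)

theory Defs
  imports
    Complex_Main
    "HOL-Computational_Algebra.Polynomial"
    "HOL-Computational_Algebra.Formal_Power_Series"
    "HOL-Computational_Algebra.Polynomial_FPS"
begin

definition real_rooted :: "real poly \<Rightarrow> bool" where
  "real_rooted p \<longleftrightarrow> p = 0 \<or> (\<forall>z::complex. poly (map_poly of_real p) z = 0 \<longrightarrow> z \<in> \<real>)"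

definition nonneg_coeffs :: "real poly \<Rightarrow> bool" where
  "nonneg_coeffs p \<longleftrightarrow> (\<forall>i. 0 \<le> coeff p i)"

definition is_veronese :: "nat \<Rightarrow> nat \<Rightarrow> real poly \<Rightarrow> real poly \<Rightarrow> bool" where
  "is_veronese n r h u \<longleftrightarrow>
     degree u \<le> n \<and>
     fps_of_poly u / (1 - fps_X) ^ n =
       Abs_fps (\<lambda>m. fps_nth (fps_of_poly h / (1 - fps_X) ^ n) (r * m))"

definition veronese :: "nat \<Rightarrow> nat \<Rightarrow> real poly \<Rightarrow> real poly" where
  "veronese n r h = (THE u. is_veronese n r h u)"

text \<open>
  The symmetry conditions are the identities \<open>a(x) = x\<^sup>m a(1/x)\<close> and \<open>b(x) = x\<^bsup>m-1\<^esup> b(1/x)\<close>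
  between rational functions. The exponent \<open>m - 1\<close> is an integer, so that for \<open>m = 0\<close> the second
  condition forces \<open>b = 0\<close>.
\<close>

definition symmetric_decomposition :: "nat \<Rightarrow> real poly \<Rightarrow> real poly \<Rightarrow> real poly \<Rightarrow> bool" where
  "symmetric_decomposition m p a b \<longleftrightarrow>
     degree p \<le> m \<and>
     p = a + [:0, 1:] * b \<and>
     (\<forall>x. x \<noteq> 0 \<longrightarrow> poly a x = x ^ m * poly a (1 / x)) \<and>
     (\<forall>x. x \<noteq> 0 \<longrightarrow> poly b x = x powi (int m - 1) * poly b (1 / x))"

definition has_nonneg_real_rooted_symmetric_decomposition :: "nat \<Rightarrow> real poly \<Rightarrow> bool" where
  "has_nonneg_real_rooted_symmetric_decomposition m p \<longleftrightarrow>
     (\<exists>a b. symmetric_decomposition m p a b \<and>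
        nonneg_coeffs a \<and> nonneg_coeffs b \<and> real_rooted a \<and> real_rooted b)"

text \<open>
  The description in \<open>veronese\<close> determines a unique polynomial: \<open>(1 - x)\<^sup>n\<close> is invertible as a power
  series, and, since \<open>(1 - x\<^sup>r)\<^sup>n = (1 - x)\<^sup>n (1 + x + \<dots> + x\<^bsup>r-1\<^esup>)\<^sup>n\<close>, the polynomial is obtained from
  \<open>h(x) (1 + x + \<dots> + x\<^bsup>r-1\<^esup>)\<^sup>n\<close>, of degree at most \<open>r n\<close>, by keeping every \<open>r\<close>-th coefficient.
\<close>

lemma section_mult_one_minus_X_power:
  fixes A :: "real fps"
  assumes "r \<ge> 1"
  shows "Abs_fps (\<lambda>m. fps_nth (A * (1 - fps_X ^ r) ^ n) (r * m)) =
         Abs_fps (\<lambda>m. fps_nth A (r * m)) * (1 - fps_X) ^ n"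
proof (induction n arbitrary: A)
  case 0
  show ?case by simp
next
  case (Suc n)
  have step: "Abs_fps (\<lambda>m. fps_nth (A * (1 - fps_X ^ r)) (r * m)) =
        Abs_fps (\<lambda>m. fps_nth A (r * m)) * (1 - fps_X)"
  proof (rule fps_ext)
    fix m
    show "fps_nth (Abs_fps (\<lambda>m. fps_nth (A * (1 - fps_X ^ r)) (r * m))) m =
          fps_nth (Abs_fps (\<lambda>m. fps_nth A (r * m)) * (1 - fps_X)) m"
      using assms
      by (cases m) (auto simp: right_diff_distrib fps_X_power_mult_right_nth)
  qed
  show ?case
    using Suc[of "A * (1 - fps_X ^ r)"] step by (simp add: mult.assoc)
qed

lemma ex1_is_veronese:
  assumes "r \<ge> 1" "degree h \<le> n"
  shows "\<exists>!u. is_veronese n r h u"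
proof -
  define g :: "real poly" where "g = (\<Sum>i<r. monom 1 i)"
  define F where "F = h * g ^ n"
  define u where "u = Poly (map (\<lambda>m. coeff F (r * m)) [0..<Suc n])"
  define D :: "real fps" where "D = (1 - fps_X) ^ n"
  have D0: "fps_nth D 0 \<noteq> 0" unfolding D_def by (simp add: fps_nth_power_0)
  have D: "x / D = y \<longleftrightarrow> x = y * D" for x y
  proof -
    have i: "inverse D * D = 1" using D0 by (rule inverse_mult_eq_1)
    have "x / D = x * inverse D" using D0 by (rule fps_divide_unit)
    thus ?thesis using i by (metis mult.assoc mult.commute mult.right_neutral)
  qed
  have dg: "degree g \<le> r - 1"
    unfolding g_def by (intro degree_sum_le) (auto intro: order_trans[OF degree_monom_le])
  have "degree F \<le> n + (r - 1) * n"
    unfolding F_def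
    by (intro order_trans[OF degree_mult_le] add_mono assms order_trans[OF degree_power_le] mult_mono dg) auto
  also have "\<dots> = r * n" using assms by (cases r) auto
  finally have dF: "degree F \<le> r * n" .
  have cu: "coeff u m = coeff F (r * m)" for m
  proof (cases "m \<le> n")
    case True
    thus ?thesis unfolding u_def by (simp add: nth_default_def del: upt_Suc)
  next
    case False
    hence "r * n < r * m" using assms by simp
    with dF have "coeff F (r * m) = 0" by (intro coeff_eq_0) linarith
    thus ?thesis using False unfolding u_def by (simp add: nth_default_def del: upt_Suc)
  qed
  have du: "degree u \<le> n"
    by (rule degree_le) (use dF assms in \<open>auto simp: cu intro!: coeff_eq_0 elim: order.strict_trans1\<close>)
  have gg: "fps_of_poly g * (1 - fps_X) = 1 - fps_X ^ r"
    unfolding g_def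
    by (simp add: fps_of_poly_sum fps_of_poly_monom' one_diff_power_eq mult.commute)
  have "fps_of_poly F = (fps_of_poly h / D) * (1 - fps_X ^ r) ^ n"
  proof -
    have "(1 - fps_X ^ r) ^ n = fps_of_poly g ^ n * D"
      by (simp add: D_def gg[symmetric] power_mult_distrib)
    moreover have "(fps_of_poly h / D) * D = fps_of_poly h" using D by metis
    ultimately show ?thesis
      by (simp add: F_def fps_of_poly_mult fps_of_poly_power mult_ac)
  qed
  hence "fps_of_poly u = Abs_fps (\<lambda>m. fps_nth (fps_of_poly h / D) (r * m)) * D"
    using section_mult_one_minus_X_power[OF assms(1), of "fps_of_poly h / D" n]
    by (metis (mono_tags, lifting) D_def cu fps_ext fps_nth_Abs_fps fps_of_poly_nth)
  hence *: "is_veronese n r h u"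
    using du unfolding is_veronese_def D_def[symmetric] D by simp
  show ?thesis
  proof (rule ex1I[of _ u])
    show "is_veronese n r h u" by (fact *)
  next
    fix v assume "is_veronese n r h v"
    with * show "v = u"
      unfolding is_veronese_def D_def[symmetric] D by (metis fps_of_poly_eq_iff)
  qed
qed

end

theory Submission imports Defs begin

text \<open>
  Put \<open>g = 1 + x + \<dots> + x\<^bsup>r-1\<^esup>\<close> and let \<open>S\<close> keep every \<open>r\<close>-th coefficient, so that the Veronese
  polynomial is \<open>S(h g\<^sup>n)\<close>. Let \<open>h\<^sup>*(x) = x\<^sup>n h(1/x)\<close>. Since \<open>S(x\<^sup>r F) = x S(F)\<close>, splitting \<open>g h\<close> as
  \<open>(h - x\<^sup>r h\<^sup>*)/(1 - x) + x\<^sup>r (h\<^sup>* - h)/(1 - x)\<close>, multiplying by \<open>g\<^bsup>n-1\<^esup>\<close> and applying \<open>S\<close> gives the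
  symmetric decomposition in (a); the one in (b) comes from
  \<open>g h = (h - h\<^sup>*)/(1 - x) + (h\<^sup>* - x\<^sup>r h)/(1 - x)\<close>. The coefficients of these quotients are partial
  sums of coefficients of \<open>h\<close>, and the hypotheses say exactly that those of \<open>\<plusminus>(h\<^sup>* - h)/(1 - x)\<close> are
  nonnegative.

  Each part has the form \<open>\<Sum>\<^sub>j (A\<^sub>j + B\<^sub>j x) \<phi>\<^sub>j\<close> with \<open>\<phi>\<^sub>j = S(x\<^sup>j g\<^bsup>n-1\<^esup>)\<close> for \<open>j < r\<close>, nonnegative weights and
  \<open>A\<^sub>k B\<^sub>l \<le> A\<^sub>l B\<^sub>k\<close> for \<open>k < l\<close>. Instead of interlacing roots we use that, for \<open>z\<close> in the open upper
  half-plane, \<open>\<phi>\<^sub>j(z)/\<phi>\<^sub>i(z)\<close> has argument between \<open>0\<close> and \<open>arg z\<close> whenever \<open>i \<le> j\<close>. This condition is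
  bilinear, propagates along the recursion in \<open>n\<close>, and with \<open>P = \<Sum>\<^sub>j A\<^sub>j \<phi>\<^sub>j\<close> and \<open>Q = \<Sum>\<^sub>j B\<^sub>j \<phi>\<^sub>j\<close> it
  yields \<open>Im (P(z)/Q(z)) \<ge> 0\<close>, which excludes \<open>P(z) + z Q(z) = 0\<close>.
\<close>

section \<open>Cones of arguments in the upper half-plane\<close>

text \<open>
  For \<open>z\<close> in the open upper half-plane this is the cone of \<open>w\<close> with \<open>w = 0\<close> or \<open>0 \<le> arg w \<le> arg z\<close>.
\<close>

definition arg_cone :: "complex \<Rightarrow> complex set" where
  "arg_cone z = {w. 0 \<le> Im w \<and> 0 \<le> Im (z * cnj w)}"

lemma arg_cone_add: "w \<in> arg_cone z \<Longrightarrow> w' \<in> arg_cone z \<Longrightarrow> w + w' \<in> arg_cone z"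
  by (auto simp: arg_cone_def algebra_simps)

lemma arg_cone_sum: "(\<And>i. i \<in> I \<Longrightarrow> f i \<in> arg_cone z) \<Longrightarrow> sum f I \<in> arg_cone z"
proof (induction I rule: infinite_finite_induct)
  case (insert i I)
  thus ?case by (simp add: arg_cone_add)
qed (simp_all add: arg_cone_def)

lemma arg_cone_scale:
  assumes "w \<in> arg_cone z" "0 \<le> c"
  shows "of_real c * w \<in> arg_cone z"
proof -
  have "Im (of_real c * w) = c * Im w" "Im (z * cnj (of_real c * w)) = c * Im (z * cnj w)"
    by (simp_all add: algebra_simps)
  with assms show ?thesis by (simp add: arg_cone_def del: complex_cnj_mult times_complex.simps)
qed

text \<open>The map from \<open>w\<close> to \<open>z * cnj w\<close> sends an argument t to arg z -
  t and exchanges the two defining conditions of the cone, one of them up to the factor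
  |z|^2.\<close>

lemma arg_cone_flip:
  assumes "w \<in> arg_cone z"
  shows "z * cnj w \<in> arg_cone z"
proof -
  have "z * cnj (z * cnj w) = of_real ((cmod z)\<^sup>2) * w"
    using complex_norm_square[of z] by (simp add: mult_ac)
  hence "Im (z * cnj (z * cnj w)) = Im (of_real ((cmod z)\<^sup>2) * w)" by (rule arg_cong)
  also have "\<dots> = (cmod z)\<^sup>2 * Im w" by simp
  finally have "Im (z * cnj (z * cnj w)) = (cmod z)\<^sup>2 * Im w" .
  with assms show ?thesis
    by (simp add: arg_cone_def del: complex_cnj_mult times_complex.simps)
qed

lemma of_real_in_arg_cone: "0 \<le> Im z \<Longrightarrow> 0 \<le> c \<Longrightarrow> of_real c \<in> arg_cone z"
  by (simp add: arg_cone_def mult_nonneg_nonneg)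

text \<open>Both defining functionals are nonnegative on the cone, so a zero sum makes each vanish
  at every term; for \<open>z\<close> off the real axis they vanish together only at 0.\<close>

lemma arg_cone_pointed:
  assumes "0 < Im z" "finite I" "\<And>i. i \<in> I \<Longrightarrow> f i \<in> arg_cone z" "sum f I = 0" "i \<in> I"
  shows "f i = 0"
proof -
  have "(\<Sum>i\<in>I. Im (f i)) = 0" using assms(4) by (metis Im_sum zero_complex.sel(2))
  hence 1: "Im (f i) = 0"
    using assms by (subst (asm) sum_nonneg_eq_0_iff) (auto simp: arg_cone_def)
  have "(\<Sum>i\<in>I. z * cnj (f i)) = 0"
    using assms(4) by (metis cnj_sum complex_cnj_zero mult_zero_right sum_distrib_left)
  hence "(\<Sum>i\<in>I. Im (z * cnj (f i))) = 0" by (metis Im_sum zero_complex.sel(2))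
  hence 2: "Im (z * cnj (f i)) = 0"
    using assms(2,3,5)
    by (subst (asm) sum_nonneg_eq_0_iff) (auto simp: arg_cone_def simp del: times_complex.simps)
  from 1 2 assms(1) show ?thesis by (simp add: complex_eq_iff)
qed

section \<open>Chains of complex numbers ordered by argument\<close>

text \<open>Angles add up along a chain, so the condition concerns all pairs and not just
  neighbours. Later entries may vanish, as for \<open>phi r 0\<close>; the nonzero
  \<open>v 0\<close> is a common reference direction.\<close>

definition arg_chain :: "complex \<Rightarrow> nat \<Rightarrow> (nat \<Rightarrow> complex) \<Rightarrow> bool" where
  "arg_chain z r v \<longleftrightarrow> v 0 \<noteq> 0 \<and> (\<forall>i j. i \<le> j \<longrightarrow> j < r \<longrightarrow> cnj (v i) * v j \<in> arg_cone z)"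

lemma arg_chainD: "arg_chain z r v \<Longrightarrow> i \<le> j \<Longrightarrow> j < r \<Longrightarrow> cnj (v i) * v j \<in> arg_cone z"
  by (simp add: arg_chain_def)

text \<open>Multiplication by \<open>cnj (v 0)\<close> moves all entries into one pointed
  cone.\<close>

lemma arg_chain_sum_eq_0:
  assumes "arg_chain z r v" "0 < Im z" "\<And>j. j < r \<Longrightarrow> 0 \<le> c j"
    and "(\<Sum>j<r. of_real (c j) * v j) = 0" "j < r"
  shows "of_real (c j) * v j = 0"
proof -
  have "of_real (c j) * (cnj (v 0) * v j) = 0"
  proof (rule arg_cone_pointed[where f = "\<lambda>j. of_real (c j) * (cnj (v 0) * v j)" and I = "{..<r}"])
    show "(\<Sum>j<r. of_real (c j) * (cnj (v 0) * v j)) = 0"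
      using assms(4) by (simp add: mult.left_commute flip: sum_distrib_left)
  qed (use assms in \<open>auto intro!: arg_cone_scale arg_chainD\<close>)
  thus ?thesis using assms(1) by (simp add: arg_chain_def)
qed

text \<open>With X the sum below \<open>j\<close> and Y the rest, a zero would give
  \<open>cnj X * Y\<close> = -|X|^2 z. This lies outside the cone unless X = 0; then the total sum
  is 0, which forces \<open>v 0\<close> = 0.\<close>

lemma rotation_sum_nonzero:
  assumes "arg_chain z r v" "0 < Im z" "j \<le> r" "0 < r"
  shows "(\<Sum>k=j..<r. v k) + z * (\<Sum>k<j. v k) \<noteq> 0"
proof
  define X where "X = (\<Sum>k<j. v k)"
  define Y where "Y = (\<Sum>k=j..<r. v k)"
  assume "(\<Sum>k=j..<r. v k) + z * (\<Sum>k<j. v k) = 0"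
  hence Y: "Y = - (z * X)" by (simp add: X_def Y_def add_eq_0_iff2)
  have "cnj X * Y \<in> arg_cone z"
    unfolding X_def Y_def cnj_sum sum_product
    by (intro arg_cone_sum arg_chainD[OF assms(1)]) auto
  moreover have "cnj X * Y = - (of_real ((cmod X)\<^sup>2) * z)"
    using complex_norm_square[of X] by (simp add: Y mult_ac)
  ultimately have "(cmod X)\<^sup>2 * Im z \<le> 0" by (simp add: arg_cone_def)
  hence "X = 0" using assms(2) by (simp add: mult_le_0_iff)
  have "(\<Sum>k<r. v k) = X + Y"
    using assms(3) by (simp add: X_def Y_def lessThan_atLeast0 sum.atLeastLessThan_concat)
  hence "(\<Sum>k<r. of_real ((\<lambda>_. 1) k) * v k) = 0" using \<open>X = 0\<close> Y by simp
  from arg_chain_sum_eq_0[OF assms(1,2) _ this \<open>0 < r\<close>] assms(1)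
  show False by (simp add: arg_chain_def)
qed

text \<open>This is one step of the recursion \<open>phi_Suc\<close>. With X the block between
  \<open>i\<close> and \<open>j\<close> and Y the remainder, the two sums are X + Y and Y + z X, and
  their product expands into four members of the cone.\<close>

lemma arg_chain_rotation_sums:
  assumes "arg_chain z r v" "0 < Im z" "0 < r"
  shows "arg_chain z r (\<lambda>j. (\<Sum>k=j..<r. v k) + z * (\<Sum>k<j. v k))"
  unfolding arg_chain_def
proof (intro conjI allI impI)
  show "(\<Sum>k=0..<r. v k) + z * (\<Sum>k<0. v k) \<noteq> 0"
    using rotation_sum_nonzero[OF assms(1,2), of 0] assms(3) by simp
next
  fix i j assume ij: "i \<le> j" "j < r"
  define X where "X = (\<Sum>k=i..<j. v k)"
  define Y where "Y = (\<Sum>k=j..<r. v k) + z * (\<Sum>k<i. v k)"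
  have s: "(\<Sum>k=i..<r. v k) = X + (\<Sum>k=j..<r. v k)" "(\<Sum>k<j. v k) = (\<Sum>k<i. v k) + X"
    using ij by (simp_all add: X_def lessThan_atLeast0 sum.atLeastLessThan_concat)
  have "cnj X * (\<Sum>k=j..<r. v k) \<in> arg_cone z"
    unfolding X_def cnj_sum sum_product
    by (intro arg_cone_sum arg_chainD[OF assms(1)]) auto
  moreover have "cnj (\<Sum>k<i. v k) * X \<in> arg_cone z"
    unfolding X_def cnj_sum sum_product
    by (intro arg_cone_sum arg_chainD[OF assms(1)]) (use ij in auto)
  \<comment> \<open>The block below \<open>i\<close> precedes X, so its product with X comes in the
    opposite order; \<open>arg_cone_flip\<close> corrects this using the factor
    \<open>z\<close>.\<close>
  ultimately have "cnj X * (\<Sum>k=j..<r. v k) + z * cnj (cnj (\<Sum>k<i. v k) * X) \<in> arg_cone z"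
    by (intro arg_cone_add arg_cone_flip)
  hence XY: "cnj X * Y \<in> arg_cone z" by (simp add: Y_def algebra_simps)
  have sq: "cnj w * w \<in> arg_cone z" for w
    using of_real_in_arg_cone[of z "(cmod w)\<^sup>2"] assms(2) complex_norm_square[of w]
    by (simp add: mult.commute)
  have "(cnj X * Y + z * cnj (cnj X * X)) + (cnj Y * Y + z * cnj (cnj X * Y)) \<in> arg_cone z"
    by (intro arg_cone_add arg_cone_flip XY sq)
  also have "(cnj X * Y + z * cnj (cnj X * X)) + (cnj Y * Y + z * cnj (cnj X * Y)) =
      cnj (X + Y) * (Y + z * X)" by (simp add: algebra_simps)
  also have "X + Y = (\<Sum>k=i..<r. v k) + z * (\<Sum>k<i. v k)" by (simp add: s Y_def)
  also have "Y + z * X = (\<Sum>k=j..<r. v k) + z * (\<Sum>k<j. v k)"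
    by (simp add: s Y_def algebra_simps)
  finally show "cnj ((\<Sum>k=i..<r. v k) + z * (\<Sum>k<i. v k)) *
      ((\<Sum>k=j..<r. v k) + z * (\<Sum>k<j. v k)) \<in> arg_cone z" .
qed

lemma Im_cnj_sum_mult_sum_nonneg:
  fixes v :: "nat \<Rightarrow> complex"
  assumes "arg_chain z r v"
    and minor: "\<And>k l. k < l \<Longrightarrow> l < r \<Longrightarrow> B l * A k \<le> B k * A l"
  shows "0 \<le> Im (cnj (\<Sum>j<r. of_real (B j) * v j) * (\<Sum>j<r. of_real (A j) * v j))"
proof -
  define T where "T k l = Im (cnj (v k) * v l)" for k l
  have T: "T l k = - T k l" for k l by (simp add: T_def)
  \<comment> \<open>Antisymmetry of \<open>T\<close> turns the double sum into one over the 2x2 minors of \<open>A\<close> and \<open>B\<close>.\<close>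
  let ?S = "\<Sum>k<r. \<Sum>l<r. B k * A l * T k l"
  have "Im (cnj (\<Sum>j<r. of_real (B j) * v j) * (\<Sum>j<r. of_real (A j) * v j)) =
      (\<Sum>k<r. \<Sum>l<r. Im (cnj (of_real (B k) * v k) * (of_real (A l) * v l)))"
    by (simp only: cnj_sum sum_product Im_sum)
  also have "\<dots> = ?S" by (simp add: T_def algebra_simps)
  finally have eq: "Im (cnj (\<Sum>j<r. of_real (B j) * v j) * (\<Sum>j<r. of_real (A j) * v j)) = ?S" .
  have "?S = (\<Sum>k<r. \<Sum>l<r. B l * A k * T l k)" by (rule sum.swap)
  hence "2 * ?S = (\<Sum>k<r. \<Sum>l<r. B k * A l * T k l) + (\<Sum>k<r. \<Sum>l<r. B l * A k * T l k)" by simp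
  also have "\<dots> = (\<Sum>k<r. \<Sum>l<r. (B k * A l - B l * A k) * T k l)"
    unfolding sum.distrib[symmetric] by (intro sum.cong refl) (subst T, simp add: algebra_simps)
  also have "\<dots> \<ge> 0"
  proof (intro sum_nonneg)
    fix k l assume kl: "k \<in> {..<r}" "l \<in> {..<r}"
    have pos: "0 \<le> T k l" if "k \<le> l" "l < r" for k l
      using arg_chainD[OF assms(1) that] by (simp add: T_def arg_cone_def)
    consider "k < l" | "k = l" | "l < k" by linarith
    thus "0 \<le> (B k * A l - B l * A k) * T k l"
    proof cases
      case 1 thus ?thesis using minor[of k l] pos[of k l] kl by simp
    next
      case 2 thus ?thesis by simp
    next
      case 3
      have "0 \<le> (B l * A k - B k * A l) * T l k" using minor[of l k] pos[of l k] kl 3 by simp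
      also have "\<dots> = (B k * A l - B l * A k) * T k l" by (subst T) (simp add: algebra_simps)
      finally show ?thesis .
    qed
  qed
  finally show ?thesis using eq by simp
qed

text \<open>P + z Q = 0 gives Im (cnj Q P) = -|Q|^2 Im z, against
  \<open>Im_cnj_sum_mult_sum_nonneg\<close> unless P = Q = 0. The termwise conclusion covers
  combinations that vanish identically.\<close>

lemma arg_chain_linear_combination_eq_0:
  assumes "arg_chain z r v" "0 < Im z"
    and "\<And>j. j < r \<Longrightarrow> 0 \<le> A j" "\<And>j. j < r \<Longrightarrow> 0 \<le> B j"
    and minor: "\<And>k l. k < l \<Longrightarrow> l < r \<Longrightarrow> B l * A k \<le> B k * A l"
    and "(\<Sum>j<r. (of_real (A j) + z * of_real (B j)) * v j) = 0" "j < r"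
  shows "of_real (A j) * v j = 0 \<and> of_real (B j) * v j = 0"
proof -
  define P where "P = (\<Sum>j<r. of_real (A j) * v j)"
  define Q where "Q = (\<Sum>j<r. of_real (B j) * v j)"
  have "P + z * Q = 0"
    using assms(6) by (simp add: P_def Q_def sum_distrib_left sum.distrib algebra_simps)
  hence P: "P = - (z * Q)" by (simp add: add_eq_0_iff2)
  have "0 \<le> Im (cnj Q * P)"
    unfolding P_def Q_def using assms(1) minor by (rule Im_cnj_sum_mult_sum_nonneg)
  moreover have "cnj Q * P = - (of_real ((cmod Q)\<^sup>2) * z)"
    using complex_norm_square[of Q] by (simp add: P mult_ac)
  ultimately have "(cmod Q)\<^sup>2 * Im z \<le> 0" by simp
  hence "Q = 0" using assms(2) by (simp add: mult_le_0_iff)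
  with P have "P = 0" by simp
  show ?thesis
    using arg_chain_sum_eq_0[OF assms(1,2,3) \<open>P = 0\<close>[unfolded P_def] assms(7)]
      arg_chain_sum_eq_0[OF assms(1,2,4) \<open>Q = 0\<close>[unfolded Q_def] assms(7)] by simp
qed


section \<open>Sections of multiples of powers of the geometric polynomial\<close>

definition sect :: "nat \<Rightarrow> real poly \<Rightarrow> real poly" where
  "sect r F = Abs_poly (\<lambda>m. coeff F (r * m))"

definition geo :: "nat \<Rightarrow> real poly" where
  "geo r = (\<Sum>i<r. monom 1 i)"

lemma coeff_sect:
  assumes "0 < r"
  shows "coeff (sect r F) m = coeff F (r * m)"
proof -
  have "coeff F (r * m) = 0" if "m > degree F" for m
  proof (rule coeff_eq_0)
    have "m \<le> r * m" using assms by simp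
    with that show "degree F < r * m" by linarith
  qed
  thus ?thesis unfolding sect_def by (subst coeff_Abs_poly[of "degree F"]) auto
qed

lemma sect_add: "0 < r \<Longrightarrow> sect r (F + F') = sect r F + sect r F'"
  by (rule poly_eqI) (simp add: coeff_sect)

lemma sect_smult: "0 < r \<Longrightarrow> sect r (smult c F) = smult c (sect r F)"
  by (rule poly_eqI) (simp add: coeff_sect)

lemma sect_sum: "0 < r \<Longrightarrow> sect r (\<Sum>i\<in>I. F i) = (\<Sum>i\<in>I. sect r (F i))"
  by (rule poly_eqI) (simp add: coeff_sect coeff_sum)

lemma sect_monom_mult:
  assumes "0 < r"
  shows "sect r (monom 1 (r + k) * F) = pCons 0 (sect r (monom 1 k * F))"
proof (rule poly_eqI)
  fix m
  have m: "monom 1 (r + k) * F = monom 1 r * (monom 1 k * F)"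
    by (simp add: mult_monom flip: mult.assoc)
  show "coeff (sect r (monom 1 (r + k) * F)) m = coeff (pCons 0 (sect r (monom 1 k * F))) m"
    unfolding coeff_sect[OF assms] m coeff_monom_mult[of 1 r]
    using assms by (cases m) (simp_all add: coeff_sect del: coeff_monom_mult)
qed

definition phi :: "nat \<Rightarrow> nat \<Rightarrow> nat \<Rightarrow> real poly" where
  "phi r N j = sect r (monom 1 j * geo r ^ N)"

lemma phi_0:
  assumes "j < r"
  shows "phi r 0 j = (if j = 0 then 1 else 0)"
  using assms by (intro poly_eqI) (auto simp: phi_def coeff_sect)

text \<open>Multiplying x^j by \<open>geo r\<close> gives the exponents from \<open>j\<close> to
  \<open>j + r - 1\<close>; those from \<open>r\<close> on wrap around to \<open>k < j\<close> at
  the cost of a factor x.\<close>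

lemma phi_Suc:
  assumes "j < r"
  shows "phi r (Suc N) j = (\<Sum>k=j..<r. phi r N k) + pCons 0 (\<Sum>k<j. phi r N k)"
proof -
  have r: "0 < r" using assms by simp
  have "monom 1 j * geo r = (\<Sum>i=0..<r. monom 1 (i + j))"
    by (simp add: geo_def sum_distrib_left mult_monom add.commute lessThan_atLeast0)
  also have "\<dots> = (\<Sum>k=j..<r + j. monom 1 k)"
    using sum.shift_bounds_nat_ivl[of "\<lambda>k. monom (1::real) k" 0 j r] by simp
  also have "\<dots> = (\<Sum>k=j..<r. monom 1 k) + (\<Sum>k=r..<r + j. monom 1 k)"
    using assms by (simp add: sum.atLeastLessThan_concat)
  also have "(\<Sum>k=r..<r + j. monom 1 k) = (\<Sum>k<j. monom (1::real) (r + k))"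
    using sum.shift_bounds_nat_ivl[of "\<lambda>k. monom (1::real) k" 0 r j]
    by (simp add: lessThan_atLeast0 add.commute)
  finally have "monom 1 j * geo r ^ Suc N =
      (\<Sum>k=j..<r. monom 1 k * geo r ^ N) + (\<Sum>k<j. monom 1 (r + k) * geo r ^ N)"
    by (simp only: power_Suc mult.assoc[symmetric] distrib_right sum_distrib_right)
  moreover have "(\<Sum>k<j. pCons 0 (p k)) = pCons 0 (\<Sum>k<j. p k)" for p :: "nat \<Rightarrow> real poly"
    by (induction j) simp_all
  ultimately show ?thesis
    using r by (simp add: phi_def sect_add sect_sum sect_monom_mult del: power_Suc)
qed

section \<open>Complex evaluation and real-rootedness\<close>

abbreviation cpoly :: "real poly \<Rightarrow> complex \<Rightarrow> complex" where
  "cpoly p z \<equiv> poly (map_poly of_real p) z"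

lemma cpoly_add: "cpoly (p + q) z = cpoly p z + cpoly q z"
proof -
  have "map_poly of_real (p + q) = (map_poly of_real p + map_poly of_real q :: complex poly)"
    by (rule poly_eqI) (simp add: coeff_map_poly)
  thus ?thesis by simp
qed

lemma cpoly_sum: "cpoly (\<Sum>i\<in>I. f i) z = (\<Sum>i\<in>I. cpoly (f i) z)"
  by (induction I rule: infinite_finite_induct) (simp_all add: cpoly_add)

lemma cpoly_smult: "cpoly (smult c p) z = of_real c * cpoly p z"
  by (simp add: map_poly_smult)

lemma cpoly_pCons_0: "cpoly (pCons 0 p) z = z * cpoly p z"
  by (simp add: map_poly_pCons)

lemma cpoly_cnj: "cpoly p (cnj z) = cnj (cpoly p z)"
  by (induction p) (simp_all add: map_poly_pCons)

text \<open>Roots of a real polynomial come in conjugate pairs, so the upper half-plane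
  suffices.\<close>

lemma real_rootedI:
  assumes "\<And>z. 0 < Im z \<Longrightarrow> cpoly p z = 0 \<Longrightarrow> p = 0"
  shows "real_rooted p"
  unfolding real_rooted_def
proof (rule disjCI)
  assume "\<not> (\<forall>z. cpoly p z = 0 \<longrightarrow> z \<in> \<real>)"
  then obtain z where z: "cpoly p z = 0" "z \<notin> \<real>" by blast
  hence "0 < Im z \<or> 0 < Im (cnj z)" by (auto simp: complex_is_Real_iff)
  moreover have "cpoly p (cnj z) = 0" using z(1) by (simp add: cpoly_cnj)
  ultimately show "p = 0" using z(1) assms by blast
qed

lemma arg_chain_phi:
  assumes "0 < r" "0 < Im z"
  shows "arg_chain z r (\<lambda>j. cpoly (phi r N j) z)"
proof (induction N)
  case 0
  have "1 \<in> arg_cone z" "0 \<in> arg_cone z"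
    using of_real_in_arg_cone[of z 0] of_real_in_arg_cone[of z 1] assms(2) by simp_all
  thus ?case using assms by (auto simp: arg_chain_def phi_0)
next
  case (Suc N)
  have "cpoly (phi r (Suc N) j) z =
      (\<Sum>k=j..<r. cpoly (phi r N k) z) + z * (\<Sum>k<j. cpoly (phi r N k) z)" if "j < r" for j
    using that by (simp only: phi_Suc cpoly_add cpoly_pCons_0 cpoly_sum)
  with arg_chain_rotation_sums[OF Suc assms(2,1)] assms(1) show ?case
    by (simp add: arg_chain_def)
qed

text \<open>For positive \<open>N\<close> the recursion writes the value as a rotation sum, which is
  nonzero; for \<open>N = 0\<close> the polynomial is 1 or 0.\<close>

lemma phi_nonvanishing:
  assumes "j < r" "0 < Im z" "cpoly (phi r N j) z = 0"
  shows "phi r N j = 0"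
proof (cases N)
  case 0
  with assms show ?thesis by (auto simp: phi_0 split: if_splits)
next
  case (Suc M)
  have "0 < r" using assms(1) by simp
  from rotation_sum_nonzero[OF arg_chain_phi[OF this assms(2)] assms(2) _ this, of j M] assms(1,3)
  show ?thesis by (simp only: Suc phi_Suc cpoly_add cpoly_pCons_0 cpoly_sum)
qed

text \<open>The two halves of a polynomial of degree below \<open>2 * r\<close>: after sectioning,
  the exponent \<open>r + j\<close> contributes x times what \<open>j\<close> does.\<close>

definition two_block :: "nat \<Rightarrow> (nat \<Rightarrow> real) \<Rightarrow> (nat \<Rightarrow> real) \<Rightarrow> real poly" where
  "two_block r A B = (\<Sum>j<r. smult (A j) (monom 1 j) + smult (B j) (monom 1 (r + j)))"

lemma coeff_two_block:
  "coeff (two_block r A B) k = (if k < r then A k else if k < 2 * r then B (k - r) else 0)"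
proof -
  have "coeff (two_block r A B) k =
      (\<Sum>j<r. if j = k then A k else 0) + (\<Sum>j<r. if r \<le> k \<and> j = k - r then B (k - r) else 0)"
    unfolding two_block_def coeff_sum sum.distrib[symmetric]
    by (intro sum.cong) auto
  also have "\<dots> = (if k < r then A k else if k < 2 * r then B (k - r) else 0)"
    by (cases "r \<le> k") auto
  finally show ?thesis .
qed

lemma real_rooted_sect_two_block:
  assumes r: "0 < r"
    and "\<And>j. j < r \<Longrightarrow> 0 \<le> A j" "\<And>j. j < r \<Longrightarrow> 0 \<le> B j"
    and "\<And>k l. k < l \<Longrightarrow> l < r \<Longrightarrow> B l * A k \<le> B k * A l"
  shows "real_rooted (sect r (two_block r A B * geo r ^ N))"
proof (rule real_rootedI)
  have eq: "sect r (two_block r A B * geo r ^ N) =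
      (\<Sum>j<r. smult (A j) (phi r N j) + smult (B j) (pCons 0 (phi r N j)))"
    unfolding two_block_def sum_distrib_right distrib_right mult_smult_left
    by (simp add: sect_sum sect_add sect_smult r sect_monom_mult phi_def)
  fix z :: complex
  assume z: "0 < Im z" and 0: "cpoly (sect r (two_block r A B * geo r ^ N)) z = 0"
  have "(\<Sum>j<r. (of_real (A j) + z * of_real (B j)) * cpoly (phi r N j) z) = 0"
    using 0 unfolding eq
    by (simp add: cpoly_sum cpoly_add cpoly_smult cpoly_pCons_0 algebra_simps del: smult_pCons)
  note zero = arg_chain_linear_combination_eq_0[where A = A and B = B,
      OF arg_chain_phi[OF r z] z _ _ _ this]
  \<comment> \<open>Each weight is 0 or \<open>phi r N j\<close> vanishes at \<open>z\<close>, hence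
    identically.\<close>
  have "smult (A j) (phi r N j) + smult (B j) (pCons 0 (phi r N j)) = 0" if "j < r" for j
    using zero[OF _ _ _ that] assms(2-4) phi_nonvanishing[OF that z, of N] by auto
  thus "sect r (two_block r A B * geo r ^ N) = 0" unfolding eq by (intro sum.neutral) auto
qed

section \<open>Palindromic polynomials\<close>

text \<open>The prescribed \<open>d\<close> may exceed the degree. Stating the symmetry by
  evaluation matches \<open>symmetric_decomposition\<close> and makes products immediate.\<close>

definition palindromic :: "nat \<Rightarrow> real poly \<Rightarrow> bool" where
  "palindromic d p \<longleftrightarrow> (\<forall>x. x \<noteq> 0 \<longrightarrow> poly p x = x ^ d * poly p (1 / x))"

lemma palindromicD: "palindromic d p \<Longrightarrow> x \<noteq> 0 \<Longrightarrow> poly p x = x ^ d * poly p (1 / x)"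
  unfolding palindromic_def by blast

lemma palindromic_mult:
  assumes "palindromic d p" "palindromic e q"
  shows "palindromic (d + e) (p * q)"
  unfolding palindromic_def poly_mult
proof (intro allI impI)
  fix x :: real assume "x \<noteq> 0"
  show "poly p x * poly q x = x ^ (d + e) * (poly p (1 / x) * poly q (1 / x))"
    unfolding palindromicD[OF assms(1) \<open>x \<noteq> 0\<close>] palindromicD[OF assms(2) \<open>x \<noteq> 0\<close>]
    by (simp only: power_add mult_ac)
qed

lemma palindromic_power:
  assumes "palindromic d p"
  shows "palindromic (d * n) (p ^ n)"
  unfolding palindromic_def poly_power
proof (intro allI impI)
  fix x :: real assume "x \<noteq> 0"
  show "poly p x ^ n = x ^ (d * n) * poly p (1 / x) ^ n"
    unfolding palindromicD[OF assms \<open>x \<noteq> 0\<close>] by (simp only: power_mult_distrib power_mult)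
qed

lemma poly_eq_sum_atMost: "degree p \<le> d \<Longrightarrow> poly p x = (\<Sum>i\<le>d. coeff p i * x ^ i)"
  for p :: "real poly"
  by (simp add: poly_altdef, rule sum.mono_neutral_left) (auto simp: coeff_eq_0)

lemma power_mult_poly_inverse:
  fixes p :: "real poly"
  assumes "degree p \<le> d" "x \<noteq> 0"
  shows "x ^ d * poly p (1 / x) = poly (\<Sum>i\<le>d. monom (coeff p (d - i)) i) x"
proof -
  have "x ^ d * poly p (1 / x) = (\<Sum>i\<le>d. coeff p i * x ^ (d - i))"
    unfolding poly_eq_sum_atMost[OF assms(1)] sum_distrib_left
    using assms(2) by (intro sum.cong) (auto simp: power_divide power_diff)
  also have "\<dots> = (\<Sum>i\<le>d. coeff p (d - i) * x ^ i)"
    by (rule sum.reindex_bij_witness[of _ "\<lambda>i. d - i" "\<lambda>i. d - i"]) auto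
  finally show ?thesis by (simp add: poly_sum poly_monom)
qed

lemma palindromicI_coeff:
  assumes "degree p \<le> d" "\<And>i. i \<le> d \<Longrightarrow> coeff p (d - i) = coeff p i"
  shows "palindromic d p"
  unfolding palindromic_def
proof (intro allI impI)
  fix x :: real assume "x \<noteq> 0"
  have "(\<Sum>i\<le>d. coeff p (d - i) * x ^ i) = (\<Sum>i\<le>d. coeff p i * x ^ i)"
    by (intro sum.cong) (auto simp: assms(2))
  thus "poly p x = x ^ d * poly p (1 / x)"
    unfolding power_mult_poly_inverse[OF assms(1) \<open>x \<noteq> 0\<close>] poly_eq_sum_atMost[OF assms(1), of x]
    by (simp add: poly_sum poly_monom)
qed

lemma palindromic_coeff:
  assumes "palindromic d p" "degree p \<le> d" "i \<le> d"
  shows "coeff p (d - i) = coeff p i"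
proof -
  \<comment> \<open>The symmetry says nothing at \<open>x = 0\<close>; the extra factor x makes both
    sides agree there.\<close>
  have "pCons 0 p = pCons 0 (\<Sum>i\<le>d. monom (coeff p (d - i)) i)"
  proof (rule poly_ext)
    fix x :: real
    show "poly (pCons 0 p) x = poly (pCons 0 (\<Sum>i\<le>d. monom (coeff p (d - i)) i)) x"
      using palindromicD[OF assms(1), of x, THEN trans, OF _ power_mult_poly_inverse[OF assms(2)]]
      by (cases "x = 0") simp_all
  qed
  hence "coeff p i = coeff (\<Sum>i\<le>d. monom (coeff p (d - i)) i) i" by simp
  thus ?thesis using assms(3) by (simp add: coeff_sum)
qed

lemma degree_sect:
  assumes "0 < r" "degree F \<le> r * d"
  shows "degree (sect r F) \<le> d"
proof (rule degree_le, intro allI impI)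
  fix m assume "d < m"
  hence "r * d < r * m" using assms(1) by simp
  hence "degree F < r * m" using assms(2) by linarith
  thus "coeff (sect r F) m = 0" using assms(1) by (simp add: coeff_sect coeff_eq_0)
qed

text \<open>Reversal in degree \<open>r * d\<close> sends \<open>r * i\<close> to
  \<open>r * (d - i)\<close>, so it preserves the exponents that the section keeps.\<close>

lemma palindromic_sect:
  assumes "0 < r" "degree F \<le> r * d" "palindromic (r * d) F"
  shows "palindromic d (sect r F)"
proof (rule palindromicI_coeff)
  show "degree (sect r F) \<le> d" using assms by (intro degree_sect)
  fix i assume "i \<le> d"
  thus "coeff (sect r F) (d - i) = coeff (sect r F) i"
    using palindromic_coeff[OF assms(3,2), of "r * i"] assms(1)
    by (simp add: coeff_sect diff_mult_distrib2)
qed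

lemma coeff_geo: "coeff (geo r) k = (if k < r then 1 else 0)"
  by (simp add: geo_def coeff_sum)

lemma degree_geo: "degree (geo r) \<le> r - 1"
  by (rule degree_le) (auto simp: coeff_geo)

lemma palindromic_geo: "0 < r \<Longrightarrow> palindromic (r - 1) (geo r)"
  by (rule palindromicI_coeff[OF degree_geo]) (auto simp: coeff_geo)

lemma nonneg_coeffs_mult: "nonneg_coeffs p \<Longrightarrow> nonneg_coeffs q \<Longrightarrow> nonneg_coeffs (p * q)"
  by (auto simp: nonneg_coeffs_def coeff_mult intro!: sum_nonneg)

lemma nonneg_coeffs_geo_power: "nonneg_coeffs (geo r ^ N)"
proof (induction N)
  case 0
  show ?case by (simp add: nonneg_coeffs_def)
next
  case (Suc N)
  thus ?case using nonneg_coeffs_mult[of "geo r" "geo r ^ N"]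
    by (simp add: nonneg_coeffs_def coeff_geo)
qed

lemma nonneg_coeffs_sect: "0 < r \<Longrightarrow> nonneg_coeffs F \<Longrightarrow> nonneg_coeffs (sect r F)"
  by (simp add: nonneg_coeffs_def coeff_sect)

text \<open>The symmetry degrees of the factors add up; the last hypothesis makes the total a
  multiple of \<open>r\<close>.\<close>

lemma sect_two_block_palindromic:
  assumes "0 < r" "degree (two_block r A B) \<le> s"
    and "\<And>i. i \<le> s \<Longrightarrow> coeff (two_block r A B) (s - i) = coeff (two_block r A B) i"
    and "s + (r - 1) * N = r * d"
  shows "palindromic d (sect r (two_block r A B * geo r ^ N))"
    and "degree (sect r (two_block r A B * geo r ^ N)) \<le> d"
proof -
  have deg: "degree (two_block r A B * geo r ^ N) \<le> r * d"
    unfolding assms(4)[symmetric]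
    by (intro order_trans[OF degree_mult_le] add_mono assms(2) order_trans[OF degree_power_le]
        mult_mono degree_geo) auto
  moreover have "palindromic (r * d) (two_block r A B * geo r ^ N)"
    unfolding assms(4)[symmetric] using assms(1-3)
    by (intro palindromic_mult palindromic_power palindromic_geo palindromicI_coeff)
  ultimately show "palindromic d (sect r (two_block r A B * geo r ^ N))"
    "degree (sect r (two_block r A B * geo r ^ N)) \<le> d"
    using assms(1) palindromic_sect degree_sect by blast+
qed

lemma nonneg_sect_two_block:
  assumes "0 < r" "\<And>j. j < r \<Longrightarrow> 0 \<le> A j" "\<And>j. j < r \<Longrightarrow> 0 \<le> B j"
  shows "nonneg_coeffs (sect r (two_block r A B * geo r ^ N))"
  using assms
  by (intro nonneg_coeffs_sect nonneg_coeffs_mult nonneg_coeffs_geo_power)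
    (auto simp: nonneg_coeffs_def coeff_two_block)

section \<open>The Veronese polynomial as a section\<close>

text \<open>As \<open>geo r\<close> is (1 - x^r)/(1 - x), the product is h/(1 - x)^n times (1 -
  x^r)^n, and sectioning turns the last factor into (1 - x)^n. Uniqueness identifies the
  result.\<close>

lemma veronese_eq_sect:
  assumes "1 \<le> r" "degree h \<le> n"
  shows "veronese n r h = sect r (h * geo r ^ n)"
proof -
  define D :: "real fps" where "D = (1 - fps_X) ^ n"
  have D0: "fps_nth D 0 \<noteq> 0" unfolding D_def by (simp add: fps_nth_power_0)
  have D: "x / D = y \<longleftrightarrow> x = y * D" for x y
  proof -
    have "x / D = x * inverse D" using D0 by (rule fps_divide_unit)
    thus ?thesis using inverse_mult_eq_1[OF D0]
      by (metis mult.assoc mult.commute mult.right_neutral)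
  qed
  have "degree (h * geo r ^ n) \<le> n + (r - 1) * n"
    by (intro order_trans[OF degree_mult_le] add_mono assms(2) order_trans[OF degree_power_le]
        mult_mono degree_geo) auto
  also have "\<dots> = r * n" using assms(1) by (cases r) auto
  finally have deg: "degree (sect r (h * geo r ^ n)) \<le> n"
    using assms(1) by (intro degree_sect) auto
  have "fps_of_poly (geo r) * (1 - fps_X) = 1 - fps_X ^ r"
    by (simp add: geo_def fps_of_poly_sum fps_of_poly_monom' one_diff_power_eq mult.commute)
  hence "(1 - fps_X ^ r) ^ n = fps_of_poly (geo r) ^ n * D"
    by (metis D_def power_mult_distrib)
  moreover have "(fps_of_poly h / D) * D = fps_of_poly h" using D by metis
  ultimately have F: "fps_of_poly (h * geo r ^ n) = (fps_of_poly h / D) * (1 - fps_X ^ r) ^ n"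
    by (simp add: fps_of_poly_mult fps_of_poly_power mult_ac)
  have "fps_of_poly (sect r (h * geo r ^ n)) =
      Abs_fps (\<lambda>m. fps_nth ((fps_of_poly h / D) * (1 - fps_X ^ r) ^ n) (r * m))"
    unfolding F[symmetric] using assms(1) by (intro fps_ext) (simp add: coeff_sect)
  also have "\<dots> = Abs_fps (\<lambda>m. fps_nth (fps_of_poly h / D) (r * m)) * D"
    unfolding D_def by (rule section_mult_one_minus_X_power[OF assms(1)])
  finally have "is_veronese n r h (sect r (h * geo r ^ n))"
    using deg unfolding is_veronese_def D_def[symmetric] D by simp
  thus ?thesis
    unfolding veronese_def using ex1_is_veronese[OF assms] by (rule the1_equality[rotated])
qed

section \<open>Partial sums, the coefficients of h/(1 - x)\<close>

definition csum :: "real poly \<Rightarrow> nat \<Rightarrow> real" where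
  "csum h k = (\<Sum>j\<le>k. coeff h j)"

lemma csum_mono: "nonneg_coeffs h \<Longrightarrow> i \<le> j \<Longrightarrow> csum h i \<le> csum h j"
  unfolding csum_def by (intro sum_mono2) (auto simp: nonneg_coeffs_def)

lemma csum_nonneg: "nonneg_coeffs h \<Longrightarrow> 0 \<le> csum h i"
  unfolding csum_def by (intro sum_nonneg) (auto simp: nonneg_coeffs_def)

lemma csum_degree: "degree h \<le> n \<Longrightarrow> n \<le> k \<Longrightarrow> csum h k = csum h n"
  unfolding csum_def by (intro sum.mono_neutral_right) (auto intro: coeff_eq_0)

text \<open>A window of \<open>r\<close> coefficients is a difference of two partial sums.\<close>

lemma coeff_geo_mult:
  "coeff (geo r * h) k = csum h k - (if k < r then 0 else csum h (k - r))"
proof -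
  have "coeff (geo r * h) k = (\<Sum>i\<le>k. (if i < r then 1 else 0) * coeff h (k - i))"
    by (simp add: coeff_mult coeff_geo)
  also have "\<dots> = (\<Sum>j\<le>k. (if k - j < r then 1 else 0) * coeff h j)"
    by (rule sum.reindex_bij_witness[of _ "\<lambda>i. k - i" "\<lambda>i. k - i"]) auto
  also have "\<dots> = (\<Sum>j\<le>k. coeff h j - (if r \<le> k - j then coeff h j else 0))"
    by (intro sum.cong) auto
  also have "\<dots> = csum h k - (\<Sum>j\<le>k. if r \<le> k - j then coeff h j else 0)"
    by (simp add: sum_subtractf csum_def)
  also have "(\<Sum>j\<le>k. if r \<le> k - j then coeff h j else 0) = (\<Sum>j\<in>{j\<in>{..k}. r \<le> k - j}. coeff h j)"
    by (rule sum.inter_filter[symmetric]) simp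
  also have "\<dots> = (if k < r then 0 else csum h (k - r))"
  proof (cases "k < r")
    case False
    hence "{j\<in>{..k}. r \<le> k - j} = {..k - r}" by auto
    thus ?thesis using False by (simp add: csum_def)
  qed (auto intro!: sum.neutral)
  finally show ?thesis .
qed

lemma csum_reverse:
  assumes "i < n"
  shows "(\<Sum>j=0..i. coeff h (n - j)) = csum h n - csum h (n - 1 - i)"
proof -
  have "csum h n - csum h (n - 1 - i) = (\<Sum>j\<in>{..n} - {..n - 1 - i}. coeff h j)"
    unfolding csum_def by (subst sum_diff) auto
  also have "\<dots> = (\<Sum>j=0..i. coeff h (n - j))"
    by (rule sum.reindex_bij_witness[of _ "\<lambda>j. n - j" "\<lambda>j. n - j"]) (use assms in auto)
  finally show ?thesis by simp
qed


section \<open>Symmetric building blocks of the decompositions\<close>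

lemma sect_symmetric_block:
  assumes "1 \<le> n" "n \<le> r" "\<And>j. n \<le> j \<Longrightarrow> D j = 0" "\<And>j. j < n \<Longrightarrow> D (n - 1 - j) = D j"
  shows "palindromic (n - 1) (sect r (two_block r D (\<lambda>_. 0) * geo r ^ (n - 1)))"
    and "degree (sect r (two_block r D (\<lambda>_. 0) * geo r ^ (n - 1))) \<le> n - 1"
proof -
  have "0 < r" using assms by simp
  moreover have "degree (two_block r D (\<lambda>_. 0)) \<le> n - 1"
    by (rule degree_le) (auto simp: coeff_two_block assms(3))
  moreover have "coeff (two_block r D (\<lambda>_. 0)) (n - 1 - i) = coeff (two_block r D (\<lambda>_. 0)) i"
    if "i \<le> n - 1" for i
    using that assms(1,2) assms(4)[of i] by (auto simp: coeff_two_block)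
  moreover have "n - 1 + (r - 1) * (n - 1) = r * (n - 1)"
    using assms by (cases r) auto
  ultimately show "palindromic (n - 1) (sect r (two_block r D (\<lambda>_. 0) * geo r ^ (n - 1)))"
    "degree (sect r (two_block r D (\<lambda>_. 0) * geo r ^ (n - 1))) \<le> n - 1"
    using sect_two_block_palindromic by blast+
qed

text \<open>The coefficients run from \<open>A 0\<close> to \<open>A (r - 1)\<close> and then from
  \<open>A (n - 1)\<close> down to \<open>A 0\<close>, a palindrome because \<open>A\<close> is
  constant from \<open>n\<close> on. The degrees fit: r + n - 1 + (r - 1)(n - 1) = r n.\<close>

lemma sect_two_block_reversed_weights:
  assumes "1 \<le> n" "n \<le> r" "\<And>j. n \<le> j \<Longrightarrow> A j = A n"
  defines "B \<equiv> (\<lambda>j. if j < n then A (n - 1 - j) else 0)"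
  shows "palindromic n (sect r (two_block r A B * geo r ^ (n - 1)))"
    and "degree (sect r (two_block r A B * geo r ^ (n - 1))) \<le> n"
proof -
  have "0 < r" using assms by simp
  moreover have "degree (two_block r A B) \<le> r + n - 1"
    by (rule degree_le) (use assms(1) in \<open>auto simp: coeff_two_block B_def\<close>)
  moreover have "coeff (two_block r A B) (r + n - 1 - i) = coeff (two_block r A B) i"
    if "i \<le> r + n - 1" for i
  proof -
    consider "i < n" | "n \<le> i" "i < r" | "r \<le> i" by linarith
    thus ?thesis
    proof cases
      case 1
      hence "r + n - 1 - i - r = n - 1 - i" "n - 1 - (n - 1 - i) = i" by auto
      thus ?thesis using 1 assms(1,2) by (auto simp: coeff_two_block B_def)
    next
      case 2
      hence "n \<le> r + n - 1 - i" "r + n - 1 - i < r" using assms(1) by auto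
      thus ?thesis using 2 assms(3)[of i] assms(3)[of "r + n - 1 - i"]
        by (simp add: coeff_two_block)
    next
      case 3
      hence "n - 1 - (i - r) = r + n - 1 - i" "i - r < n" using that assms(1) by auto
      thus ?thesis using 3 that assms(1,2) by (auto simp: coeff_two_block B_def)
    qed
  qed
  moreover have "r + n - 1 + (r - 1) * (n - 1) = r * n"
    using assms(1,2) by (cases r; cases n) auto
  ultimately show "palindromic n (sect r (two_block r A B * geo r ^ (n - 1)))"
    "degree (sect r (two_block r A B * geo r ^ (n - 1))) \<le> n"
    using sect_two_block_palindromic by blast+
qed

text \<open>\<open>A\<close> is nondecreasing and its truncated reversal \<open>B\<close>
  nonincreasing, which gives the condition on the minors.\<close>

lemma nonneg_real_rooted_sect_two_block_mono:
  assumes "1 \<le> n" "n \<le> r" "\<And>j. 0 \<le> A j" "\<And>i j. i \<le> j \<Longrightarrow> A i \<le> A j"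
  defines "B \<equiv> (\<lambda>j. if j < n then A (n - 1 - j) else 0)"
  shows "nonneg_coeffs (sect r (two_block r A B * geo r ^ N))"
    and "real_rooted (sect r (two_block r A B * geo r ^ N))"
proof -
  have B: "0 \<le> B j" for j using assms(3) by (simp add: B_def)
  have "B l * A k \<le> B k * A l" if "k < l" for k l
    using that assms(3) by (intro mult_mono B assms(4)) (auto simp: B_def intro!: assms(4))
  thus "nonneg_coeffs (sect r (two_block r A B * geo r ^ N))"
    "real_rooted (sect r (two_block r A B * geo r ^ N))"
    using assms(1-3) B by (auto intro!: nonneg_sect_two_block real_rooted_sect_two_block)
qed

lemma veronese_eq_sect_pred:
  assumes "1 \<le> n" "n \<le> r" "degree h \<le> n"
  shows "veronese n r h = sect r ((geo r * h) * geo r ^ (n - 1))"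
proof -
  have "h * geo r ^ n = (geo r * h) * geo r ^ (n - 1)"
    using assms(1) by (cases n) (simp_all add: mult_ac)
  moreover have "1 \<le> r" using assms by linarith
  ultimately show ?thesis using veronese_eq_sect[OF _ assms(3)] by metis
qed

section \<open>The two decompositions\<close>

lemma veronese_decomposition_ending_heavy:
  fixes h :: "real poly"
  assumes n: "1 \<le> n" and r: "n \<le> r" and deg: "degree h \<le> n" and nonneg: "nonneg_coeffs h"
    and le: "\<And>i. i \<le> n div 2 \<Longrightarrow> i < n \<Longrightarrow> csum h i \<le> csum h n - csum h (n - 1 - i)"
  shows "has_nonneg_real_rooted_symmetric_decomposition n (veronese n r h)"
proof -
  let ?C = "csum h"
  \<comment> \<open>With k the reversal of \<open>h\<close>, \<open>?C\<close> followed by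
    \<open>B\<close> lists the coefficients of (h - x^r k)/(1 - x), and \<open>D\<close> those of (k
    - h)/(1 - x).\<close>
  define B where "B = (\<lambda>j. if j < n then ?C (n - 1 - j) else 0)"
  define D where "D = (\<lambda>j. if j < n then ?C n - ?C (n - 1 - j) - ?C j else 0)"
  define a where "a = sect r (two_block r ?C B * geo r ^ (n - 1))"
  define b where "b = sect r (two_block r D (\<lambda>_. 0) * geo r ^ (n - 1))"
  have r0: "0 < r" using n r by simp
  note C = csum_degree[OF deg]
  \<comment> \<open>The hypothesis covers only the lower half of the indices; \<open>D\<close> is
    invariant under \<open>j\<close> to \<open>n - 1 - j\<close>.\<close>
  have D0: "0 \<le> D j" for j
  proof (cases "j \<le> n div 2")
    case True
    thus ?thesis using le[of j] by (cases "j < n") (simp_all add: D_def)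
  next
    case False
    hence "n - 1 - j \<le> n div 2" by linarith
    moreover have "n - 1 - (n - 1 - j) = j" "n - 1 - j < n" if "j < n" using that by auto
    ultimately show ?thesis using le[of "n - 1 - j"] by (cases "j < n") (simp_all add: D_def)
  qed
  \<comment> \<open>The form \<open>r + 0\<close> matches \<open>sect_monom_mult\<close>, which
    produces the factor x in front of \<open>b\<close>.\<close>
  have "geo r * h = two_block r ?C B + monom 1 (r + 0) * two_block r D (\<lambda>_. 0)"
  proof (rule poly_eqI)
    fix k
    consider "k < r" | "r \<le> k" "k - r < n" | "r \<le> k" "n \<le> k - r" by linarith
    thus "coeff (geo r * h) k =
        coeff (two_block r ?C B + monom 1 (r + 0) * two_block r D (\<lambda>_. 0)) k"
    proof cases
      case 1
      thus ?thesis by (simp add: coeff_geo_mult coeff_two_block coeff_monom_mult)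
    next
      case 2
      thus ?thesis using r C[of k]
        by (simp add: coeff_geo_mult coeff_two_block coeff_monom_mult B_def D_def)
    next
      case 3
      thus ?thesis using r C[of k] C[of "k - r"]
        by (simp add: coeff_geo_mult coeff_two_block coeff_monom_mult B_def D_def)
    qed
  qed
  hence "veronese n r h = a + pCons 0 b"
    unfolding veronese_eq_sect_pred[OF n r deg] a_def b_def
    using sect_monom_mult[OF r0, of 0] r0
    by (simp add: distrib_right sect_add mult.assoc)
  moreover have "palindromic n a" "degree a \<le> n" "nonneg_coeffs a" "real_rooted a"
    unfolding a_def B_def using sect_two_block_reversed_weights[where A = ?C, OF n r C]
      nonneg_real_rooted_sect_two_block_mono[where A = ?C, OF n r csum_nonneg csum_mono, OF nonneg nonneg]
    by blast+
  moreover have "palindromic (n - 1) b" "degree b \<le> n - 1"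
    unfolding b_def by (rule sect_symmetric_block[OF n r]; auto simp: D_def)+
  moreover have "nonneg_coeffs b" "real_rooted b"
    unfolding b_def using r0 D0
    by (auto intro!: nonneg_sect_two_block real_rooted_sect_two_block)
  moreover from calculation have "degree (a + pCons 0 b) \<le> n"
    using n by (intro degree_add_le) (auto simp: degree_pCons_eq_if)
  moreover have "int n - 1 = int (n - 1)" using n by simp
  ultimately show ?thesis
    unfolding has_nonneg_real_rooted_symmetric_decomposition_def symmetric_decomposition_def
    by (intro exI[of _ a] exI[of _ b])
      (auto simp del: of_nat_diff simp: power_int_of_nat dest: palindromicD)
qed

text \<open>Here the second part \<open>e\<close> is palindromic for \<open>n\<close> with zero
  constant term, so it is x times a \<open>b\<close> of symmetry degree n - 2.\<close>

lemma veronese_decomposition_beginning_heavy: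
  fixes h :: "real poly"
  assumes n: "1 \<le> n" and r: "n \<le> r" and deg: "degree h \<le> n" and nonneg: "nonneg_coeffs h"
    and top: "coeff h n = 0"
    and ge: "\<And>i. i \<le> n div 2 \<Longrightarrow> i < n \<Longrightarrow> csum h n - csum h (n - 1 - i) \<le> csum h i"
  shows "has_nonneg_real_rooted_symmetric_decomposition (n - 1) (veronese n r h)"
proof -
  let ?C = "csum h"
  \<comment> \<open>\<open>E\<close> followed by \<open>B\<close> belongs to (k - x^r h)/(1 - x),
    and \<open>D\<close> to (h - k)/(1 - x), with k the reversal of \<open>h\<close>.\<close>
  define E where "E = (\<lambda>j. ?C n - (if j < n then ?C (n - 1 - j) else 0))"
  define B where "B = (\<lambda>j. if j < n then E (n - 1 - j) else 0)"
  define D where "D = (\<lambda>j. if j < n then ?C j + ?C (n - 1 - j) - ?C n else 0)"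
  define a where "a = sect r (two_block r D (\<lambda>_. 0) * geo r ^ (n - 1))"
  define e where "e = sect r (two_block r E B * geo r ^ (n - 1))"
  have r0: "0 < r" using n r by simp
  note C = csum_degree[OF deg]
  note mono = csum_mono[OF nonneg]
  have D0: "0 \<le> D j" for j
  proof (cases "j \<le> n div 2")
    case True
    thus ?thesis using ge[of j] by (cases "j < n") (simp_all add: D_def)
  next
    case False
    hence "n - 1 - j \<le> n div 2" by linarith
    moreover have "n - 1 - (n - 1 - j) = j" "n - 1 - j < n" if "j < n" using that by auto
    ultimately show ?thesis using ge[of "n - 1 - j"] by (cases "j < n") (simp_all add: D_def)
  qed
  have E0: "0 \<le> E j" for j
    using mono[of "n - 1 - j" n] csum_nonneg[OF nonneg, of n] by (auto simp: E_def)
  have E_mono: "E i \<le> E j" if "i \<le> j" for i j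
    using mono[of "n - 1 - j" "n - 1 - i"] that csum_nonneg[OF nonneg] by (auto simp: E_def)
  have E_const: "E j = E n" if "n \<le> j" for j using that by (simp add: E_def)
  have "geo r * h = two_block r D (\<lambda>_. 0) + two_block r E B"
  proof (rule poly_eqI)
    fix k
    consider "k < n" | "n \<le> k" "k < r" | "r \<le> k" "k - r < n" | "r \<le> k" "n \<le> k - r" by linarith
    thus "coeff (geo r * h) k = coeff (two_block r D (\<lambda>_. 0) + two_block r E B) k"
    proof cases
      case 1
      thus ?thesis using r by (simp add: coeff_geo_mult coeff_two_block D_def E_def)
    next
      case 2
      thus ?thesis using C[of k] by (simp add: coeff_geo_mult coeff_two_block D_def E_def)
    next
      case 3
      hence "n - 1 - (n - 1 - (k - r)) = k - r" "n - 1 - (k - r) < n" "k < 2 * r"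
        using r by auto
      with 3 show ?thesis using n r C[of k]
        by (simp add: coeff_geo_mult coeff_two_block B_def E_def del: diff_diff_left diff_diff_cancel)
    next
      case 4
      thus ?thesis using r C[of k] C[of "k - r"]
        by (simp add: coeff_geo_mult coeff_two_block B_def)
    qed
  qed
  hence U: "veronese n r h = a + e"
    unfolding veronese_eq_sect_pred[OF n r deg] a_def e_def using r0
    by (simp add: distrib_right sect_add)
  have a: "palindromic (n - 1) a" "degree a \<le> n - 1"
    unfolding a_def by (rule sect_symmetric_block[OF n r]; auto simp: D_def)+
  have a': "nonneg_coeffs a" "real_rooted a"
    unfolding a_def using r0 D0
    by (auto intro!: nonneg_sect_two_block real_rooted_sect_two_block)
  have e: "palindromic n e" "degree e \<le> n" "nonneg_coeffs e" "real_rooted e"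
    unfolding e_def B_def using sect_two_block_reversed_weights[where A = E, OF n r E_const]
      nonneg_real_rooted_sect_two_block_mono[where A = E, OF n r E0 E_mono]
    by blast+
  \<comment> \<open>\<open>E 0\<close> equals \<open>coeff h n\<close>.\<close>
  have "E 0 = 0"
    using n top by (cases n) (simp_all add: E_def csum_def)
  hence e0: "coeff e 0 = 0"
    unfolding e_def using r0 by (simp add: coeff_sect coeff_mult coeff_two_block)
  obtain b where b: "e = pCons 0 b"
    using e0 by (cases e) auto
  \<comment> \<open>The top coefficient mirrors the constant one, so the degree drops to
    \<open>n - 1\<close>.\<close>
  have "coeff e n = 0" using palindromic_coeff[OF e(1,2), of 0] e0 by simp
  hence "degree e \<le> n - 1"
    using e(2) n by (metis One_nat_def Suc_pred degree_0 eq_zero_or_degree_less le_eq_less_or_eq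
        less_Suc_eq_le zero_le less_le_trans zero_less_one)
  hence "degree (a + e) \<le> n - 1" using a(2) by (rule degree_add_le[rotated])
  moreover have "nonneg_coeffs b"
    unfolding nonneg_coeffs_def
  proof
    fix i
    show "0 \<le> coeff b i" using e(3)[unfolded nonneg_coeffs_def, rule_format, of "Suc i"] b by simp
  qed
  moreover have "real_rooted b"
    using e(4) unfolding real_rooted_def b by (auto simp: map_poly_pCons)
  moreover have "\<forall>x. x \<noteq> 0 \<longrightarrow> poly b x = x powi (int (n - 1) - 1) * poly b (1 / x)"
  proof (intro allI impI)
    fix x :: real assume that: "x \<noteq> 0"
    \<comment> \<open>One power of x is lost on each side of the symmetry; for \<open>n = 1\<close>
      the resulting exponent is -1.\<close>
    have "x * poly b x = x ^ n * ((1 / x) * poly b (1 / x))"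
      using palindromicD[OF e(1) that] by (simp add: b)
    hence "poly b x = x ^ n / x / x * poly b (1 / x)" using that by (simp add: field_simps)
    moreover have "x powi (int (n - 1) - 1) = x ^ n / x / x"
      using that n by (simp add: power_int_diff power_int_of_nat power_diff del: of_nat_diff)
    ultimately show "poly b x = x powi (int (n - 1) - 1) * poly b (1 / x)" by simp
  qed
  moreover have "veronese n r h = a + [:0, 1:] * b" by (simp add: U b)
  ultimately show ?thesis
    using a(1) a' U
    unfolding has_nonneg_real_rooted_symmetric_decomposition_def symmetric_decomposition_def
      palindromic_def
    by metis
qed

theorem theorem1p2:
  fixes n :: nat and h :: "real poly"
  assumes "n \<ge> 1"
    and "degree h \<le> n"
    and "nonneg_coeffs h"
  shows "((\<forall>i. i \<le> n div 2 \<longrightarrow> (\<Sum>j=0..i. coeff h j) \<le> (\<Sum>j=0..i. coeff h (n - j)))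
           \<longrightarrow> (\<forall>r\<ge>n. has_nonneg_real_rooted_symmetric_decomposition n (veronese n r h)))
       \<and> (coeff h n = 0 \<and>
          (\<forall>i. 1 \<le> i \<and> i \<le> n div 2 \<longrightarrow> (\<Sum>j=0..i. coeff h j) \<ge> (\<Sum>j=1..i. coeff h (n - j)))
           \<longrightarrow> (\<forall>r\<ge>n. has_nonneg_real_rooted_symmetric_decomposition (n - 1) (veronese n r h)))"
proof (intro conjI impI allI)
  fix r assume le: "\<forall>i. i \<le> n div 2 \<longrightarrow> (\<Sum>j=0..i. coeff h j) \<le> (\<Sum>j=0..i. coeff h (n - j))"
    and "n \<le> r"
  have "csum h i \<le> csum h n - csum h (n - 1 - i)" if "i \<le> n div 2" "i < n" for i
    using le[rule_format, OF that(1)] csum_reverse[OF that(2), of h]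
    by (simp add: csum_def atLeast0AtMost)
  thus "has_nonneg_real_rooted_symmetric_decomposition n (veronese n r h)"
    using assms \<open>n \<le> r\<close> by (intro veronese_decomposition_ending_heavy) auto
next
  fix r assume *: "coeff h n = 0 \<and>
      (\<forall>i. 1 \<le> i \<and> i \<le> n div 2 \<longrightarrow> (\<Sum>j=0..i. coeff h j) \<ge> (\<Sum>j=1..i. coeff h (n - j)))"
    and "n \<le> r"
  have "csum h n - csum h (n - 1 - i) \<le> csum h i" if "i \<le> n div 2" "i < n" for i
  proof -
    have "csum h n - csum h (n - 1 - i) = (\<Sum>j=0..i. coeff h (n - j))"
      using csum_reverse[OF that(2)] by simp
    also have "\<dots> = (\<Sum>j=1..i. coeff h (n - j))"
      using * by (simp add: sum.atLeast_Suc_atMost)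
    also have "\<dots> \<le> (\<Sum>j=0..i. coeff h j)"
    \<comment> \<open>The hypothesis starts at 1; for \<open>i = 0\<close> the left sum is empty and
      \<open>coeff h 0\<close> is nonnegative.\<close>
    proof (cases "i = 0")
      case True
      thus ?thesis using assms(3) by (simp add: nonneg_coeffs_def)
    next
      case False
      thus ?thesis using * that by simp
    qed
    finally show ?thesis by (simp add: csum_def atLeast0AtMost)
  qed
  thus "has_nonneg_real_rooted_symmetric_decomposition (n - 1) (veronese n r h)"
    using assms * \<open>n \<le> r\<close> by (intro veronese_decomposition_beginning_heavy) auto
qed

end
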